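(* Let $\mathbb{F}_q$ be a finite field with $q$ elements and let $L$ be a non-abelian Lie algebra of finite dimension $n$ over $\mathbb{F}_q$. Then $d(L)\leq \frac{5}{8}$. Moreover, $d(L)=\frac{5}{8}$ if and only if $q=2$ and $L$ is isomorphic to one of the following Lie algebras over $\mathbb{F}_2$: $$H(1)\oplus A(n-3)\quad (\text{with } n\geq 3)\qquad\text{or}\qquad \langle x,y \mid [x,y]=x\rangle\oplus A(n-2)\quad (\text{with } n\ge 2).$$
   Context: For a finite-dimensional Lie algebra $L$ over the finite field $\mathbb{F}_q$ (so $L$ is a finite set), the commutativity degree of $L$ is $d(L)=\dfrac{|\{(x,y)\in L\times L \mid [x,y]=0\}|}{|L|^{2}}$. $A(k)$ denotes the abelian Lie algebra of dimension $k$. $H(1)=\langle x,y,z\mid [x,y]=z\rangle$ is the 3-dimensional Heisenberg Lie algebra with basis $x,y,z$, whose only nonzero basis bracket (up to antisymmetry) is $[x,y]=z$. $\langle x,y\mid [x,y]=x\rangle$ is the 2-dimensional Lie algebra with basis $x,y$ and $[x,y]=x$. The direct sum $L_1\oplus L_2$ of Lie algebras carries the componentwise bracket. *)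

theory Defs
  imports Complex_Main "HOL-Library.Cardinality" "HOL-Library.Product_Plus"
    "HOL-Library.Function_Algebras"
begin

text \<open>
  A Lie algebra is given by a subspace of an ambient vector space together with a bracket. Only
  the bracket of elements of that subspace is relevant. Any vector space \<open>'v\<close> is allowed
  as the ambient one, in particular the case where the subspace is all of it. Carriers are
  needed because the abelian Lie algebra of dimension \<open>k\<close> has to be an object depending
  on the natural number \<open>k\<close>.
\<close>

record ('k, 'v) lie =
  lie_carrier :: "'v set"
  lie_scale :: "'k \<Rightarrow> 'v \<Rightarrow> 'v"
  lie_bracket :: "'v \<Rightarrow> 'v \<Rightarrow> 'v"

locale lie_algebra = vector_space "lie_scale L"
  for L :: "('k :: field, 'v :: ab_group_add) lie" +
  assumes subspace_carrier: "subspace (lie_carrier L)"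
    and bracket_closed:
      "\<lbrakk>x \<in> lie_carrier L; y \<in> lie_carrier L\<rbrakk> \<Longrightarrow> lie_bracket L x y \<in> lie_carrier L"
    and bracket_add_left:
      "\<lbrakk>x \<in> lie_carrier L; y \<in> lie_carrier L; z \<in> lie_carrier L\<rbrakk> \<Longrightarrow>
        lie_bracket L (x + y) z = lie_bracket L x z + lie_bracket L y z"
    and bracket_add_right:
      "\<lbrakk>x \<in> lie_carrier L; y \<in> lie_carrier L; z \<in> lie_carrier L\<rbrakk> \<Longrightarrow>
        lie_bracket L x (y + z) = lie_bracket L x y + lie_bracket L x z"
    and bracket_scale_left:
      "\<lbrakk>x \<in> lie_carrier L; y \<in> lie_carrier L\<rbrakk> \<Longrightarrow>
        lie_bracket L (lie_scale L c x) y = lie_scale L c (lie_bracket L x y)"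
    and bracket_scale_right:
      "\<lbrakk>x \<in> lie_carrier L; y \<in> lie_carrier L\<rbrakk> \<Longrightarrow>
        lie_bracket L x (lie_scale L c y) = lie_scale L c (lie_bracket L x y)"
    and bracket_self: "x \<in> lie_carrier L \<Longrightarrow> lie_bracket L x x = 0"
    and jacobi:
      "\<lbrakk>x \<in> lie_carrier L; y \<in> lie_carrier L; z \<in> lie_carrier L\<rbrakk> \<Longrightarrow>
        lie_bracket L x (lie_bracket L y z) + lie_bracket L y (lie_bracket L z x) +
        lie_bracket L z (lie_bracket L x y) = 0"

text \<open>
  The library's \<open>dim\<close> is \<open>0\<close> for infinite-dimensional spaces as well,
  so finite-dimensionality is stated separately.
\<close>

locale fin_dim_lie_algebra = lie_algebra +
  assumes finite_spanning_set: "\<exists>B. finite B \<and> span B = lie_carrier L"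

definition lie_dim :: "('k :: field, 'v :: ab_group_add) lie \<Rightarrow> nat" where
  "lie_dim L = vector_space.dim (lie_scale L) (lie_carrier L)"

definition lie_abelian :: "('k, 'v :: zero) lie \<Rightarrow> bool" where
  "lie_abelian L \<longleftrightarrow> (\<forall>x\<in>lie_carrier L. \<forall>y\<in>lie_carrier L. lie_bracket L x y = 0)"

definition comm_degree :: "('k, 'v :: zero) lie \<Rightarrow> real" where
  "comm_degree L =
     real (card {(x, y). x \<in> lie_carrier L \<and> y \<in> lie_carrier L \<and> lie_bracket L x y = 0})
       / real (card (lie_carrier L)) ^ 2"

definition lie_iso :: "('k, 'v :: plus) lie \<Rightarrow> ('k, 'w :: plus) lie \<Rightarrow> bool"
    (infix \<open>\<cong>\<^sub>L\<close> 50) where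
  "L \<cong>\<^sub>L M \<longleftrightarrow>
     (\<exists>f. bij_betw f (lie_carrier L) (lie_carrier M) \<and>
          (\<forall>x\<in>lie_carrier L. \<forall>y\<in>lie_carrier L. f (x + y) = f x + f y) \<and>
          (\<forall>c. \<forall>x\<in>lie_carrier L. f (lie_scale L c x) = lie_scale M c (f x)) \<and>
          (\<forall>x\<in>lie_carrier L. \<forall>y\<in>lie_carrier L.
             f (lie_bracket L x y) = lie_bracket M (f x) (f y)))"

definition lie_dsum :: "('k, 'v) lie \<Rightarrow> ('k, 'w) lie \<Rightarrow> ('k, 'v \<times> 'w) lie"
    (infixr \<open>\<oplus>\<^sub>L\<close> 65) where
  "L \<oplus>\<^sub>L M =
     \<lparr>lie_carrier = lie_carrier L \<times> lie_carrier M,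
      lie_scale = (\<lambda>c (x, y). (lie_scale L c x, lie_scale M c y)),
      lie_bracket = (\<lambda>(x, y) (x', y'). (lie_bracket L x x', lie_bracket M y y'))\<rparr>"

text \<open>
  The abelian Lie algebra of dimension \<open>k\<close>, on the coordinate space of dimension
  \<open>k\<close>: sequences that vanish from index \<open>k\<close> on.
\<close>

definition lie_A :: "nat \<Rightarrow> ('k :: field, nat \<Rightarrow> 'k) lie" where
  "lie_A k =
     \<lparr>lie_carrier = {f. \<forall>i\<ge>k. f i = 0},
      lie_scale = (\<lambda>c f i. c * f i),
      lie_bracket = (\<lambda>f g. 0)\<rparr>"

text \<open>
  The Heisenberg algebra with basis \<open>x, y, z\<close> and \<open>[x, y] = z\<close>; the triple
  \<open>(a, b, c)\<close> stands for \<open>a x + b y + c z\<close>.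
\<close>

definition lie_H1 :: "('k :: field, 'k \<times> 'k \<times> 'k) lie" where
  "lie_H1 =
     \<lparr>lie_carrier = UNIV,
      lie_scale = (\<lambda>t (a, b, c). (t * a, t * b, t * c)),
      lie_bracket = (\<lambda>(a, b, c) (a', b', c'). (0, 0, a * b' - b * a'))\<rparr>"

text \<open>
  The algebra with basis \<open>x, y\<close> and \<open>[x, y] = x\<close>; the pair \<open>(a, b)\<close>
  stands for \<open>a x + b y\<close>.
\<close>

definition lie_aff :: "('k :: field, 'k \<times> 'k) lie" where
  "lie_aff =
     \<lparr>lie_carrier = UNIV,
      lie_scale = (\<lambda>t (a, b). (t * a, t * b)),
      lie_bracket = (\<lambda>(a, b) (a', b'). (a * b' - b * a', 0))\<rparr>"

lemma lie_algebra_A: "lie_algebra (lie_A k)"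
proof -
  interpret vector_space "lie_scale (lie_A k :: ('k :: field, nat \<Rightarrow> 'k) lie)"
    by unfold_locales (auto simp: lie_A_def algebra_simps fun_eq_iff)
  have "subspace (lie_carrier (lie_A k :: ('k, nat \<Rightarrow> 'k) lie))"
    unfolding subspace_def by (auto simp: lie_A_def)
  then show "lie_algebra (lie_A k :: ('k, nat \<Rightarrow> 'k) lie)"
    by unfold_locales (auto simp: lie_A_def algebra_simps fun_eq_iff)
qed

lemma lie_algebra_H1: "lie_algebra lie_H1"
proof -
  interpret vector_space "lie_scale (lie_H1 :: ('k :: field, 'k \<times> 'k \<times> 'k) lie)"
    by unfold_locales (auto simp: lie_H1_def algebra_simps)
  have "subspace (lie_carrier (lie_H1 :: ('k, 'k \<times> 'k \<times> 'k) lie))"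
    unfolding subspace_def by (auto simp: lie_H1_def)
  then show "lie_algebra (lie_H1 :: ('k, 'k \<times> 'k \<times> 'k) lie)"
    by unfold_locales (auto simp: lie_H1_def algebra_simps zero_prod_def)
qed

lemma lie_algebra_aff: "lie_algebra lie_aff"
proof -
  interpret vector_space "lie_scale (lie_aff :: ('k :: field, 'k \<times> 'k) lie)"
    by unfold_locales (auto simp: lie_aff_def algebra_simps)
  have "subspace (lie_carrier (lie_aff :: ('k, 'k \<times> 'k) lie))"
    unfolding subspace_def by (auto simp: lie_aff_def)
  then show "lie_algebra (lie_aff :: ('k, 'k \<times> 'k) lie)"
    by unfold_locales (auto simp: lie_aff_def algebra_simps zero_prod_def)
qed

lemma lie_algebra_dsum:
  fixes L :: "('k :: field, 'v :: ab_group_add) lie" and M :: "('k, 'w :: ab_group_add) lie"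
  assumes "lie_algebra L" "lie_algebra M"
  shows "lie_algebra (L \<oplus>\<^sub>L M)"
proof -
  interpret L: lie_algebra L by fact
  interpret M: lie_algebra M by fact
  interpret vector_space "lie_scale (L \<oplus>\<^sub>L M)"
    by unfold_locales
      (auto simp: lie_dsum_def L.scale_left_distrib L.scale_right_distrib
        M.scale_left_distrib M.scale_right_distrib)
  have "subspace (lie_carrier (L \<oplus>\<^sub>L M))"
    using L.subspace_carrier M.subspace_carrier
    unfolding subspace_def L.subspace_def M.subspace_def
    by (auto simp: lie_dsum_def zero_prod_def)
  then show ?thesis
    by unfold_locales
      (auto simp: lie_dsum_def zero_prod_def
        L.bracket_closed M.bracket_closed L.bracket_add_left M.bracket_add_left
        L.bracket_add_right M.bracket_add_right L.bracket_scale_left M.bracket_scale_left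
        L.bracket_scale_right M.bracket_scale_right L.bracket_self M.bracket_self
        L.jacobi M.jacobi)
qed

lemma lie_dim_A: "lie_dim (lie_A k :: ('k :: field, nat \<Rightarrow> 'k) lie) = k"
proof -
  interpret lie_algebra "lie_A k :: ('k, nat \<Rightarrow> 'k) lie"
    by (rule lie_algebra_A)
  define e :: "nat \<Rightarrow> nat \<Rightarrow> 'k" where "e j i = (if i = j then 1 else 0)" for j i
  let ?s = "lie_scale (lie_A k :: ('k, nat \<Rightarrow> 'k) lie)"
  let ?V = "lie_carrier (lie_A k :: ('k, nat \<Rightarrow> 'k) lie)"
  have inj: "inj_on e {..<k}"
    by (auto simp: inj_on_def e_def fun_eq_iff split: if_splits)
  have app: "(\<Sum>j\<in>A. g j) i = (\<Sum>j\<in>A. g j i)" for A and g :: "nat \<Rightarrow> nat \<Rightarrow> 'k" and i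
    by (induction A rule: infinite_finite_induct) auto
  have val: "(\<Sum>j<k. ?s (c j) (e j)) i = (if i < k then c i else 0)" for c i
    by (simp add: app lie_A_def e_def if_distrib cong: if_cong)
  have "independent (e ` {..<k})"
    unfolding dependent_finite[OF finite_imageI[OF finite_lessThan]]
  proof safe
    fix u j assume u: "(\<Sum>v\<in>e ` {..<k}. ?s (u v) v) = 0" and j: "j < k" "u (e j) \<noteq> 0"
    from u have "(\<Sum>j<k. ?s (u (e j)) (e j)) = 0"
      by (simp add: sum.reindex[OF inj])
    then have "(\<Sum>j<k. ?s (u (e j)) (e j)) j = 0" by simp
    with j show False by (simp add: val)
  qed
  moreover have "e ` {..<k} \<subseteq> ?V"
    by (auto simp: lie_A_def e_def)
  moreover have "?V \<subseteq> span (e ` {..<k})"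
  proof
    fix f assume "f \<in> ?V"
    then have "f = (\<Sum>j<k. ?s (f j) (e j))"
      unfolding fun_eq_iff val by (auto simp: lie_A_def)
    also have "\<dots> \<in> span (e ` {..<k})"
      by (intro span_sum span_scale span_base) auto
    finally show "f \<in> span (e ` {..<k})" .
  qed
  ultimately show ?thesis
    unfolding lie_dim_def using basis_card_eq_dim card_image[OF inj] by fastforce
qed

end

theory Submission
  imports Defs
begin

text \<open>
  Let \<open>Z\<close> be the center of \<open>L\<close> and \<open>[x, y] \<noteq> 0\<close>. Bracketing with \<open>x\<close> and \<open>y\<close> shows that
  \<open>(a, b, z) \<mapsto> a x + b y + z\<close> is injective on \<open>k \<times> k \<times> Z\<close>, so \<open>q\<^sup>2 |Z| \<le> |L|\<close>; likewise the centralizer of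
  a noncentral element has index at least \<open>q\<close>. Summing the orders of the centralizers gives
  \<open>d(L) \<le> 1/q + (1 - 1/q)/q\<^sup>2 \<le> 5/8\<close>. In the case of equality, \<open>q = 2\<close> and
  \<open>L = \<langle>x, y\<rangle> + Z\<close>, so all brackets are multiples of \<open>w = [x, y]\<close>. If \<open>w\<close> is central,
  a complement of \<open>w\<close> in \<open>Z\<close> splits off and leaves the Heisenberg algebra. Otherwise some \<open>u\<close> has
  \<open>[w, u] = w\<close>, and \<open>L = \<langle>w, u\<rangle> \<oplus> Z\<close>. Conversely, the commutativity degree is multiplicative
  on direct sums, which reduces the two families to a count over the field with two elements.
\<close>

section \<open>Coordinate spaces and their orders\<close>

lemma card_lie_A:
  "finite (lie_carrier (lie_A m :: ('k :: {field, finite}, nat \<Rightarrow> 'k) lie)) \<and>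
   card (lie_carrier (lie_A m :: ('k, nat \<Rightarrow> 'k) lie)) = CARD('k) ^ m"
proof (induction m)
  case 0
  have "lie_carrier (lie_A 0 :: ('k, nat \<Rightarrow> 'k) lie) = {0}"
    by (auto simp: lie_A_def fun_eq_iff)
  then show ?case by simp
next
  case (Suc m)
  let ?A = "\<lambda>m. lie_carrier (lie_A m :: ('k, nat \<Rightarrow> 'k) lie)"
  \<comment> \<open>Index \<open>m\<close> is the only new coordinate of
    \<open>lie_A (Suc m)\<close>; splitting it off contributes one factor
    \<open>CARD('k)\<close>.\<close>
  have "bij_betw (\<lambda>(c, f). f(m := c)) (UNIV \<times> ?A m) (?A (Suc m))"
    by (rule bij_betw_byWitness[where f' = "\<lambda>f. (f m, f(m := 0))"])
      (auto simp: lie_A_def fun_eq_iff)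
  from bij_betw_same_card[OF this] bij_betw_finite[OF this] Suc show ?case
    by (simp add: card_cartesian_product)
qed

text \<open>Serves both to count \<open>span B\<close> and to produce the abelian summand of an
  isomorphism. The linearity laws hold for all sequences because \<open>\<phi>\<close> is a linear
  combination of the first \<open>card B\<close> entries and ignores the others.\<close>

lemma (in vector_space) independent_coordinates:
  fixes B :: "'b set"
  assumes "finite B" "independent B"
  obtains \<phi> :: "(nat \<Rightarrow> 'a) \<Rightarrow> 'b"
  where "bij_betw \<phi> (lie_carrier (lie_A (card B) :: ('a, nat \<Rightarrow> 'a) lie)) (span B)"
    and "\<And>f g. \<phi> (f + g) = \<phi> f + \<phi> g"
    and "\<And>c f. \<phi> (\<lambda>i. c * f i) = c *s \<phi> f"
proof -
  define m where "m = card B"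
  obtain e where e: "bij_betw e {..<m} B"
    using ex_bij_betw_nat_finite[OF assms(1)] unfolding m_def atLeast0LessThan by blast
  define \<phi> where "\<phi> f = (\<Sum>i<m. f i *s e i)" for f
  \<comment> \<open>Indexing the same sum by the vectors of \<open>B\<close> gives it the shape in
    which independence and \<open>span\<close> are used below.\<close>
  have \<phi>_eq: "\<phi> f = (\<Sum>v\<in>B. f (the_inv_into {..<m} e v) *s v)" for f
    unfolding sum.reindex_bij_betw[OF e, of "\<lambda>v. f (the_inv_into {..<m} e v) *s v", symmetric]
    by (simp add: \<phi>_def the_inv_into_f_f[OF bij_betw_imp_inj_on[OF e]])
  have add: "\<phi> (f + g) = \<phi> f + \<phi> g" for f g
    by (simp add: \<phi>_def scale_left_distrib sum.distrib)
  have scale: "\<phi> (\<lambda>i. c * f i) = c *s \<phi> f" for c f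
    by (simp add: \<phi>_def scale_sum_right)
  have inj: "inj_on \<phi> (lie_carrier (lie_A m :: ('a, nat \<Rightarrow> 'a) lie))"
  proof (rule inj_onI)
    fix f g assume fg: "f \<in> lie_carrier (lie_A m :: ('a, nat \<Rightarrow> 'a) lie)"
      "g \<in> lie_carrier (lie_A m :: ('a, nat \<Rightarrow> 'a) lie)" "\<phi> f = \<phi> g"
    then have "(\<Sum>v\<in>B. (f (the_inv_into {..<m} e v) - g (the_inv_into {..<m} e v)) *s v) = 0"
      by (simp add: \<phi>_eq scale_left_diff_distrib sum_subtractf)
    then have *: "f (the_inv_into {..<m} e v) - g (the_inv_into {..<m} e v) = 0" if "v \<in> B" for v
      by (rule independentD[OF assms(2,1) order_refl _ that])
    show "f = g"
    proof
      fix i show "f i = g i"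
      proof (cases "i < m")
        case True
        then have "e i \<in> B" "the_inv_into {..<m} e (e i) = i"
          using e by (auto simp: bij_betw_def the_inv_into_f_f)
        with *[of "e i"] show ?thesis by simp
      next
        case False
        with fg show ?thesis by (simp add: lie_A_def)
      qed
    qed
  qed
  have "\<phi> ` lie_carrier (lie_A m :: ('a, nat \<Rightarrow> 'a) lie) = span B"
  proof (intro equalityI subsetI)
    fix v assume "v \<in> \<phi> ` lie_carrier (lie_A m :: ('a, nat \<Rightarrow> 'a) lie)"
    moreover have "\<phi> f \<in> span B" for f
      unfolding \<phi>_eq by (intro span_sum span_scale span_base)
    ultimately show "v \<in> span B" by blast
  next
    fix v assume "v \<in> span B"
    then obtain u where u: "v = (\<Sum>b\<in>B. u b *s b)"
      by (auto simp: span_finite[OF assms(1)])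
    \<comment> \<open>The value 0 from \<open>m\<close> on is what places \<open>f\<close> in the
      carrier of \<open>lie_A m\<close>.\<close>
    define f where "f i = (if i < m then u (e i) else 0)" for i
    have "v = \<phi> f"
      unfolding u \<phi>_def sum.reindex_bij_betw[OF e, of "\<lambda>b. u b *s b", symmetric]
      by (simp add: f_def)
    moreover have "f \<in> lie_carrier (lie_A m :: ('a, nat \<Rightarrow> 'a) lie)"
      by (simp add: lie_A_def f_def)
    ultimately show "v \<in> \<phi> ` lie_carrier (lie_A m :: ('a, nat \<Rightarrow> 'a) lie)" by blast
  qed
  with inj add scale that show ?thesis unfolding m_def bij_betw_def by blast
qed

section \<open>Isomorphisms, direct sums and the commutativity degree\<close>

lemma lie_iso_sym:
  assumes "lie_algebra L" "M \<cong>\<^sub>L L" "lie_algebra M"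
  shows "L \<cong>\<^sub>L M"
proof -
  interpret L: lie_algebra L by fact
  interpret M: lie_algebra M by fact
  let ?V = "lie_carrier L" and ?W = "lie_carrier M"
  obtain g where g: "bij_betw g ?W ?V"
    "\<forall>x\<in>?W. \<forall>y\<in>?W. g (x + y) = g x + g y"
    "\<forall>c. \<forall>x\<in>?W. g (lie_scale M c x) = lie_scale L c (g x)"
    "\<forall>x\<in>?W. \<forall>y\<in>?W. g (lie_bracket M x y) = lie_bracket L (g x) (g y)"
    using assms(2) unfolding lie_iso_def by blast
  define f where "f = inv_into ?W g"
  have f: "bij_betw f ?V ?W"
    unfolding f_def by (rule bij_betw_inv_into[OF g(1)])
  have fW: "f x \<in> ?W" and gf: "g (f x) = x" if "x \<in> ?V" for x
    using that f g(1) bij_betw_inv_into_right[OF g(1)] unfolding f_def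
    by (auto dest: bij_betwE)
  have fg: "f (g y) = y" if "y \<in> ?W" for y
    using that bij_betw_inv_into_left[OF g(1)] unfolding f_def by blast
  show ?thesis
    unfolding lie_iso_def
  proof (intro exI[of _ f] conjI f ballI allI)
    fix x y assume xy: "x \<in> ?V" "y \<in> ?V"
    \<comment> \<open>Each law for \<open>f\<close> follows by applying \<open>g\<close> to its
      right-hand side; closure of \<open>?W\<close> ensures that \<open>f\<close> undoes
      \<open>g\<close> there.\<close>
    have "f x + f y \<in> ?W"
      using M.subspace_add[OF M.subspace_carrier] fW xy by blast
    moreover have "g (f x + f y) = x + y"
      using g(2) fW gf xy by simp
    ultimately show "f (x + y) = f x + f y"
      using fg by metis
    have "lie_bracket M (f x) (f y) \<in> ?W"
      using M.bracket_closed fW xy by blast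
    moreover have "g (lie_bracket M (f x) (f y)) = lie_bracket L x y"
      using g(4) fW gf xy by simp
    ultimately show "f (lie_bracket L x y) = lie_bracket M (f x) (f y)"
      using fg by metis
  next
    fix c x assume x: "x \<in> ?V"
    have "lie_scale M c (f x) \<in> ?W"
      using M.subspace_scale[OF M.subspace_carrier] fW x by blast
    moreover have "g (lie_scale M c (f x)) = lie_scale L c x"
      using g(3) fW gf x by simp
    ultimately show "f (lie_scale L c x) = lie_scale M c (f x)"
      using fg by metis
  qed
qed

text \<open>An injective additive map sends a bracket to 0 only if the bracket is 0, so
  \<open>map_prod f f\<close> matches the commuting pairs of both sides.\<close>

lemma comm_degree_iso:
  fixes L :: "('k :: field, 'v :: ab_group_add) lie" and M :: "('k, 'w :: ab_group_add) lie"
  assumes "lie_algebra L" "L \<cong>\<^sub>L M"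
  shows "comm_degree L = comm_degree M"
proof -
  interpret L: lie_algebra L by fact
  let ?V = "lie_carrier L" and ?W = "lie_carrier M"
  obtain f where f: "bij_betw f ?V ?W"
    and f_add: "\<And>x y. x \<in> ?V \<Longrightarrow> y \<in> ?V \<Longrightarrow> f (x + y) = f x + f y"
    and f_bracket: "\<And>x y. x \<in> ?V \<Longrightarrow> y \<in> ?V \<Longrightarrow>
      f (lie_bracket L x y) = lie_bracket M (f x) (f y)"
    using assms(2) unfolding lie_iso_def by blast
  have zero: "0 \<in> ?V" by (rule L.subspace_0[OF L.subspace_carrier])
  have f0: "f 0 = 0" using f_add[OF zero zero] by simp
  have comm: "lie_bracket M (f x) (f y) = 0 \<longleftrightarrow> lie_bracket L x y = 0"
    if "x \<in> ?V" "y \<in> ?V" for x y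
    using inj_on_eq_iff[OF bij_betw_imp_inj_on[OF f] L.bracket_closed[OF that] zero]
      f_bracket[OF that] f0 by simp
  have inj: "inj_on (map_prod f f) {(x, y). x \<in> ?V \<and> y \<in> ?V \<and> lie_bracket L x y = 0}"
    by (rule inj_on_subset[OF map_prod_inj_on[OF bij_betw_imp_inj_on[OF f] bij_betw_imp_inj_on[OF f]]])
      auto
  have W: "?W = f ` ?V" using f by (simp add: bij_betw_def)
  have "map_prod f f ` {(x, y). x \<in> ?V \<and> y \<in> ?V \<and> lie_bracket L x y = 0} =
    {(x, y). x \<in> ?W \<and> y \<in> ?W \<and> lie_bracket M x y = 0}"
    unfolding W by (force simp: comm)
  from card_image[OF inj, unfolded this] bij_betw_same_card[OF f] show ?thesis
    by (simp add: comm_degree_def)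
qed

text \<open>A pair commutes in the sum exactly when both component pairs commute, so the commuting
  pairs form a product after regrouping.\<close>

lemma comm_degree_dsum:
  "comm_degree (L \<oplus>\<^sub>L M) = comm_degree L * comm_degree M"
proof -
  let ?C = "\<lambda>L. {(x, y). x \<in> lie_carrier L \<and> y \<in> lie_carrier L \<and> lie_bracket L x y = 0}"
  have "bij_betw (\<lambda>((x, x'), (y, y')). ((x, y), (x', y'))) (?C L \<times> ?C M) (?C (L \<oplus>\<^sub>L M))"
    by (rule bij_betw_byWitness[where f' = "\<lambda>((x, y), (x', y')). ((x, x'), (y, y'))"])
      (auto simp: lie_dsum_def zero_prod_def)
  from bij_betw_same_card[OF this]
  have "card (?C (L \<oplus>\<^sub>L M)) = card (?C L) * card (?C M)"
    by (simp add: card_cartesian_product)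
  then show ?thesis
    unfolding comm_degree_def
    by (simp add: lie_dsum_def card_cartesian_product power_mult_distrib)
qed

lemma comm_degree_A:
  "comm_degree (lie_A m :: ('k :: {field, finite}, nat \<Rightarrow> 'k) lie) = 1"
proof -
  let ?A = "lie_A m :: ('k, nat \<Rightarrow> 'k) lie"
  have "{(x, y). x \<in> lie_carrier ?A \<and> y \<in> lie_carrier ?A \<and> lie_bracket ?A x y = 0} =
    lie_carrier ?A \<times> lie_carrier ?A"
    by (auto simp: lie_A_def)
  then show ?thesis
    using card_lie_A[where 'k = 'k and m = m]
    by (simp add: comm_degree_def card_cartesian_product power2_eq_square)
qed

section \<open>Counting over the field with two elements\<close>

lemma UNIV_field_card_2:
  assumes "CARD('k :: {field, finite}) = 2"
  shows "(UNIV :: 'k set) = {0, 1}"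
  using card_subset_eq[of UNIV "{0 :: 'k, 1}"] assms by simp

text \<open>As a sum of indicators, a count over \<open>{0, 1}\<close> coordinates can be evaluated
  by the simplifier term by term.\<close>

lemma card_Collect_eq_sum:
  "card {p :: 'a :: finite. P p} = (\<Sum>p\<in>UNIV. if P p then 1 else 0)"
  by (simp flip: sum.inter_filter)

text \<open>Commuting means vanishing of a 2 by 2 determinant: 0 commutes with all 4 vectors, and
  each of the 3 others only with 0 and itself, which gives 4 + 3 * 2 = 10.\<close>

lemma card_commuting_aff:
  assumes "CARD('k :: {field, finite}) = 2"
  shows "card {(x :: 'k \<times> 'k, y). lie_bracket lie_aff x y = 0} = 10"
  unfolding card_Collect_eq_sum UNIV_Times_UNIV[symmetric] sum.cartesian_product[symmetric]
    UNIV_field_card_2[OF assms]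
  by (simp add: lie_aff_def zero_prod_def case_prod_beta)

lemma comm_degree_aff:
  assumes "CARD('k :: {field, finite}) = 2"
  shows "comm_degree (lie_aff :: ('k, 'k \<times> 'k) lie) = 5 / 8"
  using card_commuting_aff[OF assms] assms by (simp add: comm_degree_def lie_aff_def)

text \<open>The same determinant decides commuting as in \<open>lie_aff\<close>, while the two
  central coordinates are free: 10 * 4 = 40 of the 64 pairs.\<close>

lemma comm_degree_H1:
  assumes "CARD('k :: {field, finite}) = 2"
  shows "comm_degree (lie_H1 :: ('k, 'k \<times> 'k \<times> 'k) lie) = 5 / 8"
proof -
  have "bij_betw (\<lambda>(((a, b), (a', b')), (c, c')). ((a, b, c), (a', b', c')))
    ({(x :: 'k \<times> 'k, y). lie_bracket lie_aff x y = 0} \<times> UNIV)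
    {(x :: 'k \<times> 'k \<times> 'k, y). lie_bracket lie_H1 x y = 0}"
    by (rule bij_betw_byWitness[where
          f' = "\<lambda>((a, b, c), (a', b', c')). (((a, b), (a', b')), (c, c'))"])
      (auto simp: lie_aff_def lie_H1_def zero_prod_def)
  from bij_betw_same_card[OF this]
  have "card {(x :: 'k \<times> 'k \<times> 'k, y). lie_bracket lie_H1 x y = 0} = 40"
    using assms by (simp add: card_cartesian_product card_commuting_aff)
  then show ?thesis
    using assms by (simp add: comm_degree_def lie_H1_def)
qed

section \<open>Subspaces of a finite Lie algebra\<close>

locale finite_lie_algebra = fin_dim_lie_algebra L
  for L :: "('k :: {field, finite}, 'v :: ab_group_add) lie"
begin

abbreviation carrier ("V") where "V \<equiv> lie_carrier L"
abbreviation scale' (infixr "\<cdot>" 75) where "c \<cdot> x \<equiv> lie_scale L c x"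
abbreviation bracket ("\<lbrakk>_, _\<rbrakk>") where "\<lbrakk>x, y\<rbrakk> \<equiv> lie_bracket L x y"

definition center :: "'v set" where
  "center = {x \<in> V. \<forall>y\<in>V. \<lbrakk>x, y\<rbrakk> = 0}"

definition centralizer :: "'v \<Rightarrow> 'v set" where
  "centralizer x = {y \<in> V. \<lbrakk>x, y\<rbrakk> = 0}"

lemma carrier_closed [simp, intro]:
  "0 \<in> V" "x \<in> V \<Longrightarrow> y \<in> V \<Longrightarrow> x + y \<in> V" "x \<in> V \<Longrightarrow> c \<cdot> x \<in> V"
  "x \<in> V \<Longrightarrow> y \<in> V \<Longrightarrow> x - y \<in> V" "x \<in> V \<Longrightarrow> y \<in> V \<Longrightarrow> \<lbrakk>x, y\<rbrakk> \<in> V"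
  using subspace_carrier by (auto simp: subspace_0 subspace_add subspace_scale subspace_diff
      bracket_closed)

text \<open>A spanning set of \<open>V\<close> bounds the size of independent sets. The prescribed
  part \<open>A\<close> is empty for a plain basis, and a single bracket in the Heisenberg
  case.\<close>

lemma basis_of_subspace:
  assumes "subspace W" "W \<subseteq> V" "independent A" "A \<subseteq> W"
  obtains B where "A \<subseteq> B" "finite B" "independent B" "span B = W"
proof -
  obtain T where T: "finite T" "span T = V"
    using finite_spanning_set by blast
  obtain B where B: "A \<subseteq> B" "B \<subseteq> W" "independent B" "W \<subseteq> span B"
    using maximal_independent_subset_extend[OF assms(4,3)] by blast
  have "finite B"
    using independent_span_bound[OF T(1) B(3)] T(2) assms(2) B(2) by blast
  moreover have "span B = W"
    using B span_minimal[OF _ assms(1)] by blast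
  ultimately show ?thesis using B that by blast
qed

lemma finite_card_span:
  assumes "finite B" "independent B"
  shows "finite (span B)" "card (span B) = CARD('k) ^ card B"
proof -
  obtain \<phi> :: "(nat \<Rightarrow> 'k) \<Rightarrow> 'v"
    where \<phi>: "bij_betw \<phi> (lie_carrier (lie_A (card B) :: ('k, nat \<Rightarrow> 'k) lie)) (span B)"
    using independent_coordinates[OF assms] by metis
  show "finite (span B)" "card (span B) = CARD('k) ^ card B"
    using bij_betw_finite[OF \<phi>] bij_betw_same_card[OF \<phi>] card_lie_A[where 'k = 'k] by auto
qed

lemma card_subspace:
  assumes "subspace W" "W \<subseteq> V"
  shows "finite W" "card W = CARD('k) ^ dim W"
proof -
  obtain B where B: "finite B" "independent B" "span B = W"
    using basis_of_subspace[OF assms, of "{}"] independent_empty by auto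
  then show "finite W" "card W = CARD('k) ^ dim W"
    using finite_card_span[OF B(1,2)] dim_span_eq_card_independent[OF B(2)] by auto
qed

lemmas finite_carrier [simp] = card_subspace(1)[OF subspace_carrier order_refl]
  and card_carrier = card_subspace(2)[OF subspace_carrier order_refl]

lemma card_carrier_pos: "card V > 0"
  using card_gt_0_iff by force

lemma two_le_card_field: "2 \<le> CARD('k)"
  using card_mono[of UNIV "{0 :: 'k, 1}"] by simp

lemma bracket_zero [simp]:
  assumes "x \<in> V" shows "\<lbrakk>x, 0\<rbrakk> = 0" "\<lbrakk>0, x\<rbrakk> = 0"
  using bracket_add_right[OF assms, of 0 0] bracket_add_left[OF _ _ assms, of 0 0] by auto

lemma bracket_swap:
  assumes "x \<in> V" "y \<in> V" shows "\<lbrakk>y, x\<rbrakk> = - \<lbrakk>x, y\<rbrakk>"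
proof -
  have "\<lbrakk>x + y, x + y\<rbrakk> = \<lbrakk>x, y\<rbrakk> + \<lbrakk>y, x\<rbrakk>"
    using assms bracket_self[of x] bracket_self[of y]
    by (simp add: bracket_add_left bracket_add_right)
  then have "\<lbrakk>x, y\<rbrakk> + \<lbrakk>y, x\<rbrakk> = 0"
    using assms bracket_self[of "x + y"] by simp
  then show ?thesis by (simp add: eq_neg_iff_add_eq_0 add.commute)
qed

section \<open>Center and centralizers\<close>

lemma center_subset: "center \<subseteq> V"
  by (auto simp: center_def)

lemma bracket_center:
  assumes "z \<in> center" "x \<in> V" shows "\<lbrakk>z, x\<rbrakk> = 0" "\<lbrakk>x, z\<rbrakk> = 0"
proof -
  show "\<lbrakk>z, x\<rbrakk> = 0" using assms by (simp add: center_def)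
  moreover have "z \<in> V" using assms(1) center_subset by blast
  ultimately show "\<lbrakk>x, z\<rbrakk> = 0" using bracket_swap[OF _ assms(2)] by simp
qed

lemma subspace_center: "subspace center"
  unfolding subspace_def center_def
  by (auto simp: bracket_add_left bracket_scale_left)

lemma finite_center [simp]: "finite center"
  by (rule finite_subset[OF center_subset]) simp

lemma finite_centralizer [simp]: "finite (centralizer x)"
  by (simp add: centralizer_def)

text \<open>Central terms drop out and alternation leaves a determinant. This one formula gives both
  the injectivity below and the match with the brackets of the model algebras.\<close>

lemma bracket_pair_expand:
  assumes "x \<in> V" "y \<in> V" "z \<in> center" "z' \<in> center"
  shows "\<lbrakk>a \<cdot> x + b \<cdot> y + z, a' \<cdot> x + b' \<cdot> y + z'\<rbrakk> = (a * b' - b * a') \<cdot> \<lbrakk>x, y\<rbrakk>"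
proof -
  have z: "z \<in> V" "z' \<in> V" using assms(3,4) center_subset by auto
  show ?thesis
    using assms z
    by (simp add: bracket_add_left bracket_add_right bracket_scale_left bracket_scale_right
        bracket_center bracket_self bracket_swap[OF assms(1,2)] scale_left_diff_distrib mult.commute)
qed

lemma inj_pair_center:
  assumes "x \<in> V" "y \<in> V" "\<lbrakk>x, y\<rbrakk> \<noteq> 0"
  shows "inj_on (\<lambda>((a, b), z). a \<cdot> x + b \<cdot> y + z) (UNIV \<times> center)"
proof (rule inj_onI, clarsimp)
  fix a b z a' b' z'
  assume z: "z \<in> center" "z' \<in> center" and eq: "a \<cdot> x + b \<cdot> y + z = a' \<cdot> x + b' \<cdot> y + z'"
  have zero: "0 \<in> center" by (rule subspace_0[OF subspace_center])
  \<comment> \<open>With left factor \<open>1 \<cdot> x + 0 \<cdot> y + 0\<close> the expansion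
    reads off \<open>b\<close> as the coefficient of the nonzero bracket; with left factor
    \<open>y\<close> it reads off the negative of \<open>a\<close>.\<close>
  have "b = b'"
    using bracket_pair_expand[OF assms(1,2) zero, of _ 1 0] z eq assms(3)
    by (metis diff_zero mult_1 mult_zero_left scale_cancel_right)
  moreover have "a = a'"
    using bracket_pair_expand[OF assms(1,2) zero, of _ 0 1] z eq assms(3)
    by (metis diff_0 mult_1 mult_zero_left neg_equal_iff_equal scale_cancel_right)
  ultimately show "a = a' \<and> b = b' \<and> z = z'" using eq by simp
qed

lemma pair_center_subset:
  assumes "x \<in> V" "y \<in> V"
  shows "(\<lambda>((a, b), z). a \<cdot> x + b \<cdot> y + z) ` (UNIV \<times> center) \<subseteq> V"
  using assms center_subset by auto

lemma card_center_le:
  assumes "\<not> lie_abelian L"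
  shows "CARD('k)\<^sup>2 * card center \<le> card V"
proof -
  obtain x y where xy: "x \<in> V" "y \<in> V" "\<lbrakk>x, y\<rbrakk> \<noteq> 0"
    using assms by (auto simp: lie_abelian_def)
  have "card ((UNIV :: ('k \<times> 'k) set) \<times> center) \<le> card V"
    by (rule card_inj_on_le[OF inj_pair_center[OF xy] pair_center_subset[OF xy(1,2)]]) simp
  then show ?thesis by (simp add: card_cartesian_product power2_eq_square)
qed

text \<open>When the center has the extremal order, the injection is onto by counting. This yields
  the normal form of vectors on which the classification rests.\<close>

lemma bij_pair_center:
  assumes "x \<in> V" "y \<in> V" "\<lbrakk>x, y\<rbrakk> \<noteq> 0" "CARD('k)\<^sup>2 * card center = card V"
  shows "bij_betw (\<lambda>((a, b), z). a \<cdot> x + b \<cdot> y + z) (UNIV \<times> center) V"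
  unfolding bij_betw_def
proof (intro conjI inj_pair_center[OF assms(1-3)])
  show "(\<lambda>((a, b), z). a \<cdot> x + b \<cdot> y + z) ` (UNIV \<times> center) = V"
    by (rule card_subset_eq[OF _ pair_center_subset[OF assms(1,2)]])
      (use assms(4) in \<open>simp_all add: card_image[OF inj_pair_center[OF assms(1-3)]]
        card_cartesian_product power2_eq_square\<close>)
qed

text \<open>If \<open>y\<close> does not commute with \<open>x\<close>, the translates of the
  centralizer by the multiples of \<open>y\<close> are disjoint, since bracketing with
  \<open>x\<close> recovers the multiple.\<close>

lemma card_centralizer_le:
  assumes "x \<in> V" "x \<notin> center"
  shows "CARD('k) * card (centralizer x) \<le> card V"
proof -
  obtain y where y: "y \<in> V" "\<lbrakk>x, y\<rbrakk> \<noteq> 0"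
    using assms by (auto simp: center_def)
  have *: "\<lbrakk>x, a \<cdot> y + u\<rbrakk> = a \<cdot> \<lbrakk>x, y\<rbrakk>" if "u \<in> centralizer x" for a u
    using that assms y by (simp add: centralizer_def bracket_add_right bracket_scale_right)
  have "inj_on (\<lambda>(a, u). a \<cdot> y + u) (UNIV \<times> centralizer x)"
  proof (rule inj_onI, clarsimp)
    fix a u a' u'
    assume u: "u \<in> centralizer x" "u' \<in> centralizer x" and eq: "a \<cdot> y + u = a' \<cdot> y + u'"
    then have "a = a'" using *[OF u(1), of a] *[OF u(2), of a'] y(2) by simp
    with eq show "a = a' \<and> u = u'" by simp
  qed
  then have "card ((UNIV :: 'k set) \<times> centralizer x) \<le> card V"
    by (rule card_inj_on_le) (use y in \<open>auto simp: centralizer_def\<close>)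
  then show ?thesis by (simp add: card_cartesian_product)
qed

section \<open>The bound on the commutativity degree\<close>

lemma comm_degree_le_card_center:
  "comm_degree L \<le> 1 / CARD('k) + (1 - 1 / CARD('k)) * (card center / card V)"
proof -
  let ?q = "real CARD('k)" and ?N = "real (card V)" and ?z = "real (card center)"
  have q: "?q > 0" and N: "?N > 0" using card_carrier_pos by auto
  have "{(x, y). x \<in> V \<and> y \<in> V \<and> \<lbrakk>x, y\<rbrakk> = 0} = Sigma V centralizer"
    by (auto simp: centralizer_def)
  then have "real (card {(x, y). x \<in> V \<and> y \<in> V \<and> \<lbrakk>x, y\<rbrakk> = 0}) =
      (\<Sum>x\<in>V. real (card (centralizer x)))"
    by (simp add: card_SigmaI)
  also have "\<dots> = (\<Sum>x\<in>V - center. real (card (centralizer x))) +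
      (\<Sum>x\<in>center. real (card (centralizer x)))"
    by (rule sum.subset_diff[OF center_subset]) simp
  \<comment> \<open>Centralizers of noncentral elements have index at least \<open>CARD('k)\<close>;
    for central elements the trivial bound is used.\<close>
  also have "\<dots> \<le> (\<Sum>x\<in>V - center. ?N / ?q) + (\<Sum>x\<in>center. ?N)"
  proof (intro add_mono sum_mono)
    fix x assume "x \<in> V - center"
    then have "CARD('k) * card (centralizer x) \<le> card V"
      using card_centralizer_le by auto
    then have "?q * real (card (centralizer x)) \<le> ?N"
      by (metis of_nat_le_iff of_nat_mult)
    then show "real (card (centralizer x)) \<le> ?N / ?q"
      using q by (simp add: field_simps)
  next
    fix x
    have "centralizer x \<subseteq> V" by (auto simp: centralizer_def)
    then show "real (card (centralizer x)) \<le> ?N"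
      by (simp add: card_mono)
  qed
  also have "\<dots> = (?N - ?z) * (?N / ?q) + ?z * ?N"
    using card_mono[OF finite_carrier center_subset]
    by (simp add: card_Diff_subset center_subset of_nat_diff)
  finally have "comm_degree L \<le> ((?N - ?z) * (?N / ?q) + ?z * ?N) / ?N\<^sup>2"
    unfolding comm_degree_def by (rule divide_right_mono) simp
  \<comment> \<open>Proved for arbitrary reals, so that the cardinalities stay opaque, and then
    instantiated to continue the chain.\<close>
  also have "((N - z) * (N / q) + z * N) / N\<^sup>2 = 1 / q + (1 - 1 / q) * (z / N)"
    if "q > 0" "N > 0" for q N z :: real
    using that by (simp add: field_simps power2_eq_square)
  note this[OF q N]
  finally show ?thesis .
qed

lemma comm_degree_bound:
  assumes "\<not> lie_abelian L"
  shows "comm_degree L \<le> 5 / 8"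
    and "comm_degree L = 5 / 8 \<Longrightarrow> CARD('k) = 2 \<and> CARD('k)\<^sup>2 * card center = card V"
proof -
  define q where "q = real CARD('k)"
  define s where "s = real (card center) / real (card V)"
  have q: "q \<ge> 2" using two_le_card_field by (simp add: q_def)
  have N: "real (card V) > 0" using card_carrier_pos by simp
  have "q\<^sup>2 * real (card center) \<le> real (card V)"
    using card_center_le[OF assms] unfolding q_def by (metis of_nat_le_iff of_nat_mult of_nat_power)
  then have s: "s \<le> 1 / q\<^sup>2"
    using N q by (simp add: s_def field_simps)
  have d: "comm_degree L \<le> 1 / q + (1 - 1 / q) * s"
    using comm_degree_le_card_center by (simp add: q_def s_def)
  have q1: "1 - 1 / q > 0" using q by simp
  have s': "(1 - 1 / q) * s \<le> (1 - 1 / q) * (1 / q\<^sup>2)"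
    using s q1 by (intro mult_left_mono) auto
  \<comment> \<open>The factor \<open>q - 2\<close> isolates the only field size at which the bound
    reaches 5/8; the quadratic cofactor is positive for \<open>q \<ge> 2\<close>.\<close>
  have key: "5 / 8 - (1 / q + (1 - 1 / q) * (1 / q\<^sup>2)) = (q - 2) * (5 * q\<^sup>2 + 2 * q - 4) / (8 * q ^ 3)"
    using q by (simp add: field_simps power2_eq_square power3_eq_cube)
  have pos: "5 * q\<^sup>2 + 2 * q - 4 > 0"
  proof -
    have "q\<^sup>2 > 0" using q by simp
    then show ?thesis using q by linarith
  qed
  have nonneg: "(q - 2) * (5 * q\<^sup>2 + 2 * q - 4) / (8 * q ^ 3) \<ge> 0"
    using q pos by simp
  show "comm_degree L \<le> 5 / 8"
    using d s' key nonneg by linarith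
  assume eq: "comm_degree L = 5 / 8"
  have "(q - 2) * (5 * q\<^sup>2 + 2 * q - 4) / (8 * q ^ 3) = 0"
    using eq d s' key nonneg by linarith
  then have q2: "q = 2" using pos q by auto
  \<comment> \<open>Equality at 5/8 leaves no slack in the estimate of \<open>s\<close> either;
    cancelling the positive coefficient gives the extremal order of the center.\<close>
  have "(1 - 1 / q) * s \<ge> (1 - 1 / q) * (1 / q\<^sup>2)"
    using eq d s' key nonneg by linarith
  then have "s \<ge> 1 / q\<^sup>2"
    using q1 by (rule mult_left_le_imp_le)
  with s have "q\<^sup>2 * real (card center) = real (card V)"
    using N q by (simp add: s_def field_simps)
  then have "CARD('k)\<^sup>2 * card center = card V"
    unfolding q_def by (metis of_nat_eq_iff of_nat_mult of_nat_power)
  with q2 show "CARD('k) = 2 \<and> CARD('k)\<^sup>2 * card center = card V"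
    by (simp add: q_def)
qed

section \<open>Classification when the center is as large as possible\<close>

lemma dim_center:
  assumes "CARD('k)\<^sup>2 * card center = card V"
  shows "lie_dim L = dim center + 2"
proof -
  have "CARD('k) ^ (dim center + 2) = CARD('k) ^ lie_dim L"
    using assms card_subspace(2)[OF subspace_center center_subset] card_carrier
    by (simp add: lie_dim_def power_add power2_eq_square ac_simps)
  then show ?thesis
    using two_le_card_field power_inject_exp[of "CARD('k)" "dim center + 2" "lie_dim L"] by simp
qed

text \<open>The normal form is already a decomposition: \<open>x\<close> and \<open>y\<close>
  satisfy the relation of \<open>lie_aff\<close>, and a basis of the center gives the abelian part.
  The map is easier to write from the model to \<open>L\<close>, hence the reversal by
  \<open>lie_iso_sym\<close>.\<close>

lemma iso_aff:
  assumes "x \<in> V" "y \<in> V" "\<lbrakk>x, y\<rbrakk> = x" "x \<noteq> 0" "CARD('k)\<^sup>2 * card center = card V"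
  shows "L \<cong>\<^sub>L lie_aff \<oplus>\<^sub>L lie_A (dim center)"
proof (rule lie_iso_sym)
  obtain B where B: "finite B" "independent B" "span B = center"
    using basis_of_subspace[OF subspace_center center_subset, of "{}"] independent_empty by auto
  have "card B = dim center" using B dim_span_eq_card_independent by metis
  then obtain \<phi> :: "(nat \<Rightarrow> 'k) \<Rightarrow> 'v"
    where \<phi>: "bij_betw \<phi> (lie_carrier (lie_A (dim center) :: ('k, nat \<Rightarrow> 'k) lie)) center"
      and \<phi>_add: "\<And>f g. \<phi> (f + g) = \<phi> f + \<phi> g"
      and \<phi>_scale: "\<And>c f. \<phi> (\<lambda>i. c * f i) = c \<cdot> \<phi> f"
    using independent_coordinates[OF B(1,2)] B(3) by metis
  define g where "g = (\<lambda>((a, b), z). a \<cdot> x + b \<cdot> y + z) \<circ> map_prod id \<phi>"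
  have bij: "bij_betw g (lie_carrier (lie_aff \<oplus>\<^sub>L lie_A (dim center))) V"
    unfolding g_def
    by (rule bij_betw_trans[OF _ bij_pair_center[OF assms(1,2) _ assms(5)]])
      (use assms \<phi> in \<open>auto simp: lie_dsum_def lie_aff_def intro!: bij_betw_map_prod\<close>)
  have g_eq: "g ((a, b), f) = a \<cdot> x + b \<cdot> y + \<phi> f" for a b f
    by (simp add: g_def)
  have \<phi>_0: "\<phi> 0 = 0" using \<phi>_add[of 0 0] by simp
  have \<phi>_center: "\<phi> f \<in> center" if "\<forall>i\<ge>dim center. f i = 0" for f
    using bij_betwE[OF \<phi>] that by (simp add: lie_A_def)
  \<comment> \<open>The model bracket has only an \<open>x\<close> coordinate, the determinant; by
    \<open>\<lbrakk>x, y\<rbrakk> = x\<close> its image is the value given by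
    \<open>bracket_pair_expand\<close>.\<close>
  have "g (lie_bracket (lie_aff \<oplus>\<^sub>L lie_A (dim center)) p r) = \<lbrakk>g p, g r\<rbrakk>"
    if "p \<in> lie_carrier (lie_aff \<oplus>\<^sub>L lie_A (dim center))"
      "r \<in> lie_carrier (lie_aff \<oplus>\<^sub>L lie_A (dim center))" for p r
    using that by (auto simp: lie_dsum_def lie_aff_def lie_A_def g_eq \<phi>_0 \<phi>_center
        bracket_pair_expand assms(1-3))
  with bij show "lie_aff \<oplus>\<^sub>L lie_A (dim center) \<cong>\<^sub>L L"
    unfolding lie_iso_def
    by (intro exI[of _ g])
      (auto simp: lie_dsum_def lie_aff_def lie_A_def g_eq \<phi>_add \<phi>_scale algebra_simps)
qed (simp_all add: lie_algebra_axioms lie_algebra_dsum lie_algebra_aff lie_algebra_A)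

text \<open>The bracket \<open>w\<close> plays the third basis vector of \<open>lie_H1\<close>.
  Extending it to a basis of the center leaves a complement of dimension one less, which becomes the
  abelian summand.\<close>

lemma iso_H1:
  assumes "x \<in> V" "y \<in> V" "\<lbrakk>x, y\<rbrakk> \<noteq> 0" "\<lbrakk>x, y\<rbrakk> \<in> center"
    "CARD('k)\<^sup>2 * card center = card V"
  shows "dim center \<ge> 1" "L \<cong>\<^sub>L lie_H1 \<oplus>\<^sub>L lie_A (dim center - 1)"
proof -
  define w where "w = \<lbrakk>x, y\<rbrakk>"
  have w: "w \<in> center" "w \<noteq> 0" "w \<in> V" using assms center_subset by (auto simp: w_def)
  obtain B where B: "w \<in> B" "finite B" "independent B" "span B = center"
    using basis_of_subspace[OF subspace_center center_subset, of "{w}"] w by auto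
  define C where "C = B - {w}"
  have C: "finite C" "independent C" "w \<notin> span C" "B = insert w C"
    using B independent_mono[of B C] dependent_def by (auto simp: C_def)
  have "card B = dim center" using B dim_span_eq_card_independent by metis
  moreover have "card B > 0" using B by (auto simp: card_gt_0_iff)
  ultimately have card_C: "card C = dim center - 1" and "dim center \<ge> 1"
    using B by (auto simp: C_def)
  then show "dim center \<ge> 1" by simp
  from card_C obtain \<phi> :: "(nat \<Rightarrow> 'k) \<Rightarrow> 'v"
    where \<phi>: "bij_betw \<phi> (lie_carrier (lie_A (dim center - 1) :: ('k, nat \<Rightarrow> 'k) lie)) (span C)"
      and \<phi>_add: "\<And>f g. \<phi> (f + g) = \<phi> f + \<phi> g"
      and \<phi>_scale: "\<And>c f. \<phi> (\<lambda>i. c * f i) = c \<cdot> \<phi> f"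
    using independent_coordinates[OF C(1,2)] by metis
  have span_C: "span C \<subseteq> center" using B(4) C(4) span_mono[of C B] by blast
  have bij_w: "bij_betw (\<lambda>(c, u). c \<cdot> w + u) (UNIV \<times> span C) center"
    unfolding bij_betw_def
  proof
    show "inj_on (\<lambda>(c, u). c \<cdot> w + u) (UNIV \<times> span C)"
    proof (rule inj_onI, clarsimp)
      fix c u c' u' assume u: "u \<in> span C" "u' \<in> span C" and eq: "c \<cdot> w + u = c' \<cdot> w + u'"
      have "(c - c') \<cdot> w = u' - u"
        using eq by (simp add: scale_left_diff_distrib algebra_simps)
      then have "(c - c') \<cdot> w \<in> span C" using u span_diff by simp
      \<comment> \<open>For distinct \<open>c\<close> and \<open>c'\<close> this vector is
        \<open>w\<close> itself, which is not in \<open>span C\<close>.\<close>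
      then have "inverse (c - c') \<cdot> (c - c') \<cdot> w \<in> span C" by (rule span_scale)
      with C(3) have "c = c'" by (cases "c = c'") auto
      with eq show "c = c' \<and> u = u'" by simp
    qed
    show "(\<lambda>(c, u). c \<cdot> w + u) ` (UNIV \<times> span C) = center"
    proof (intro equalityI subsetI)
      fix v assume "v \<in> (\<lambda>(c, u). c \<cdot> w + u) ` (UNIV \<times> span C)"
      then show "v \<in> center"
        using w span_C subspace_center by (auto intro!: subspace_add subspace_scale)
    next
      fix v assume "v \<in> center"
      then obtain c where "v - c \<cdot> w \<in> span C"
        using B(4) C(4) span_breakdown_eq by blast
      then show "v \<in> (\<lambda>(c, u). c \<cdot> w + u) ` (UNIV \<times> span C)"
        by (intro image_eqI[of _ _ "(c, v - c \<cdot> w)"]) auto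
    qed
  qed
  define h where "h = (\<lambda>(c, u). c \<cdot> w + u) \<circ> map_prod id \<phi>"
  have h: "bij_betw h (UNIV \<times> lie_carrier (lie_A (dim center - 1))) center"
    unfolding h_def
    by (rule bij_betw_trans[OF _ bij_w]) (use \<phi> in \<open>auto intro!: bij_betw_map_prod\<close>)
  define g where "g = (\<lambda>((a, b, c), f). a \<cdot> x + b \<cdot> y + h (c, f))"
  \<comment> \<open>Regrouping moves the third Heisenberg coordinate to the central part, where
    \<open>h\<close> uses it as the coefficient of \<open>w\<close>; so \<open>g\<close> is a
    composition of known bijections.\<close>
  have g_comp: "g = (\<lambda>((a, b), z). a \<cdot> x + b \<cdot> y + z) \<circ> map_prod id h \<circ>
    (\<lambda>((a, b, c), f). ((a, b), (c, f)))"
    by (auto simp: g_def fun_eq_iff)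
  have bij: "bij_betw g (lie_carrier (lie_H1 \<oplus>\<^sub>L lie_A (dim center - 1))) V"
    unfolding g_comp
  proof (intro bij_betw_trans[OF _ bij_betw_trans[OF _ bij_pair_center[OF assms(1-3,5)]]])
    show "bij_betw (map_prod id h) (UNIV \<times> UNIV \<times> lie_carrier (lie_A (dim center - 1)))
        (UNIV \<times> center)"
      using h by (auto intro!: bij_betw_map_prod)
    show "bij_betw (\<lambda>((a, b, c), f). ((a, b), (c, f)))
        (lie_carrier (lie_H1 \<oplus>\<^sub>L lie_A (dim center - 1)))
        (UNIV \<times> UNIV \<times> lie_carrier (lie_A (dim center - 1)))"
      by (rule bij_betw_byWitness[where f' = "\<lambda>((a, b), (c, f)). ((a, b, c), f)"])
        (auto simp: lie_dsum_def lie_H1_def)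
  qed
  have h_add: "h (c + c', f + f') = h (c, f) + h (c', f')" for c c' f f'
    by (simp add: h_def \<phi>_add scale_left_distrib algebra_simps)
  have h_scale: "h (a * c, \<lambda>i. a * f i) = a \<cdot> h (c, f)" for a c f
    by (simp add: h_def \<phi>_scale scale_right_distrib)
  \<comment> \<open>A bracket in the model has only the third coordinate, so this identifies its
    image as a multiple of \<open>\<lbrakk>x, y\<rbrakk>\<close>.\<close>
  have h_0: "h (c, 0) = c \<cdot> \<lbrakk>x, y\<rbrakk>" for c
    using \<phi>_add[of 0 0] by (simp add: h_def w_def)
  have h_center: "h (c, f) \<in> center" if "\<forall>i\<ge>dim center - 1. f i = 0" for c f
    using bij_betwE[OF h] that by (simp add: lie_A_def)
  have g_eq: "g ((a, b, c), f) = a \<cdot> x + b \<cdot> y + h (c, f)" for a b c f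
    by (simp add: g_def)
  have "g (lie_bracket (lie_H1 \<oplus>\<^sub>L lie_A (dim center - 1)) p r) = \<lbrakk>g p, g r\<rbrakk>"
    if "p \<in> lie_carrier (lie_H1 \<oplus>\<^sub>L lie_A (dim center - 1))"
      "r \<in> lie_carrier (lie_H1 \<oplus>\<^sub>L lie_A (dim center - 1))" for p r
    using that by (auto simp: lie_dsum_def lie_H1_def lie_A_def g_eq h_0 h_center
        bracket_pair_expand assms(1,2))
  with bij have "lie_H1 \<oplus>\<^sub>L lie_A (dim center - 1) \<cong>\<^sub>L L"
    unfolding lie_iso_def
    by (intro exI[of _ g])
      (auto simp: lie_dsum_def lie_H1_def lie_A_def g_eq h_add h_scale algebra_simps)
  then show "L \<cong>\<^sub>L lie_H1 \<oplus>\<^sub>L lie_A (dim center - 1)"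
    by (rule lie_iso_sym[OF lie_algebra_axioms])
      (simp_all add: lie_algebra_dsum lie_algebra_H1 lie_algebra_A)
qed

lemma classification_of_large_center:
  assumes "\<not> lie_abelian L" "CARD('k)\<^sup>2 * card center = card V"
  shows "lie_dim L \<ge> 3 \<and> L \<cong>\<^sub>L lie_H1 \<oplus>\<^sub>L lie_A (lie_dim L - 3) \<or>
    lie_dim L \<ge> 2 \<and> L \<cong>\<^sub>L lie_aff \<oplus>\<^sub>L lie_A (lie_dim L - 2)"
proof -
  note n = dim_center[OF assms(2)]
  obtain x y where xy: "x \<in> V" "y \<in> V" "\<lbrakk>x, y\<rbrakk> \<noteq> 0"
    using assms(1) by (auto simp: lie_abelian_def)
  show ?thesis
  proof (cases "\<lbrakk>x, y\<rbrakk> \<in> center")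
    case True
    \<comment> \<open>By \<open>n\<close>, the index \<open>dim center - 1\<close> equals
      \<open>lie_dim L - 3\<close>, and \<open>dim center \<ge> 1\<close> becomes dimension at least
      3.\<close>
    with iso_H1[OF xy True assms(2)] n show ?thesis by simp
  next
    case False
    define w where "w = \<lbrakk>x, y\<rbrakk>"
    have w: "w \<in> V" "w \<noteq> 0" using xy by (auto simp: w_def)
    obtain u where u: "u \<in> V" "\<lbrakk>w, u\<rbrakk> \<noteq> 0"
      using False w by (auto simp: center_def w_def)
    have surj: "\<exists>a b z. z \<in> center \<and> v = a \<cdot> x + b \<cdot> y + z" if "v \<in> V" for v
      using bij_betw_imp_surj_on[OF bij_pair_center[OF xy assms(2)]] that by force
    \<comment> \<open>In normal form, any two vectors have a bracket that is a multiple of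
      \<open>\<lbrakk>x, y\<rbrakk>\<close>, that is, of \<open>w\<close>.\<close>
    obtain c where c: "\<lbrakk>w, u\<rbrakk> = c \<cdot> w"
      using surj[OF w(1)] surj[OF u(1)] bracket_pair_expand[OF xy(1,2)] unfolding w_def by metis
    have "c \<noteq> 0" using c u by auto
    \<comment> \<open>Rescaling \<open>u\<close> gives the defining relation of
      \<open>lie_aff\<close>, with \<open>w\<close> and the rescaled \<open>u\<close> in the roles
      of \<open>x\<close> and \<open>y\<close>.\<close>
    then have "\<lbrakk>w, inverse c \<cdot> u\<rbrakk> = w"
      using c w u by (simp add: bracket_scale_right)
    from iso_aff[OF w(1) carrier_closed(3)[OF u(1)] this w(2) assms(2)] n
    show ?thesis by simp
  qed
qed

end

theorem theorem4p7:
  fixes L :: "('k :: {field, finite}, 'v :: ab_group_add) lie" and n :: nat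
  assumes "fin_dim_lie_algebra L"
    and "lie_dim L = n"
    and "\<not> lie_abelian L"
  shows "comm_degree L \<le> 5 / 8 \<and>
    (comm_degree L = 5 / 8 \<longleftrightarrow>
      CARD('k) = 2 \<and>
      (n \<ge> 3 \<and> L \<cong>\<^sub>L lie_H1 \<oplus>\<^sub>L lie_A (n - 3) \<or>
       n \<ge> 2 \<and> L \<cong>\<^sub>L lie_aff \<oplus>\<^sub>L lie_A (n - 2)))"
proof -
  interpret finite_lie_algebra L
    using assms(1) by (simp add: finite_lie_algebra_def)
  \<comment> \<open>The abelian summand has degree 1, so only the small nonabelian factor
    contributes.\<close>
  have H1: "comm_degree L = 5 / 8" if "CARD('k) = 2" "L \<cong>\<^sub>L lie_H1 \<oplus>\<^sub>L lie_A (n - 3)"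
    unfolding comm_degree_iso[OF lie_algebra_axioms that(2)]
    by (simp add: comm_degree_dsum comm_degree_A comm_degree_H1[OF that(1)])
  have aff: "comm_degree L = 5 / 8" if "CARD('k) = 2" "L \<cong>\<^sub>L lie_aff \<oplus>\<^sub>L lie_A (n - 2)"
    unfolding comm_degree_iso[OF lie_algebra_axioms that(2)]
    by (simp add: comm_degree_dsum comm_degree_A comm_degree_aff[OF that(1)])
  show ?thesis
    using comm_degree_bound[OF assms(3)] H1 aff
      classification_of_large_center[OF assms(3), unfolded assms(2)] by blast
qed

end
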